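(* Let $(\Omega,\mathcal{F},P)$ be a probability space and $\{A_n\}_{n\ge 1}$ a sequence of events. Put $S_n=\sum_{k=1}^n \mathbb{I}(A_k)$ and $E_n=\sum_{k=1}^n P(A_k)$. Let $\gamma\in[0,1)$ and $C>0$. Assume that $E_n\to\infty$ as $n\to\infty$ and that $$\mathrm{Var}(S_m-S_n)\le C\,(E_m-E_n)^{1+\gamma}$$ for all $m>n$ and all sufficiently large $n$. Then, for every $\varepsilon>0$, $$S_n=E_n+o\left(E_n^{(1+\gamma)/2}(\log E_n)^{3/2}(\log\log E_n)^{(1+\varepsilon)/2}\right)\quad\text{almost surely as } n\to\infty.$$
   Context: $\mathbb{I}(A)$ denotes the indicator of the event $A$. The relation $S_n=E_n+o(h_n)$ almost surely means that $(S_n-E_n)/h_n\to 0$ as $n\to\infty$ with probability one. *)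

theory Defs
  imports "HOL-Probability.Probability"
begin

text \<open>
  Sequences of events are indexed from 1; the value \<open>A 0\<close> is never used.
\<close>

definition occurrences :: "(nat \<Rightarrow> 'a set) \<Rightarrow> nat \<Rightarrow> 'a \<Rightarrow> real" where
  "occurrences A n \<omega> = (\<Sum>k=1..n. indicator (A k) \<omega>)"

definition sum_prob :: "'a measure \<Rightarrow> (nat \<Rightarrow> 'a set) \<Rightarrow> nat \<Rightarrow> real" where
  "sum_prob M A n = (\<Sum>k=1..n. measure M (A k))"

text \<open>
  \<open>S\<^sub>n = E\<^sub>n + o(h\<^sub>n)\<close> almost surely. Division by zero and \<open>powr\<close> or \<open>ln\<close> at nonpositive
  arguments are harmless when \<open>h\<^sub>n\<close> is well-defined and positive for all large \<open>n\<close>.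
\<close>

definition as_eq_plus_smallo ::
  "'a measure \<Rightarrow> (nat \<Rightarrow> 'a \<Rightarrow> real) \<Rightarrow> (nat \<Rightarrow> real) \<Rightarrow> (nat \<Rightarrow> real) \<Rightarrow> bool" where
  "as_eq_plus_smallo M S E h \<longleftrightarrow>
     (AE \<omega> in M. (\<lambda>n. (S n \<omega> - E n) / h n) \<longlonglongrightarrow> 0)"

end

theory Submission
  imports Defs "HOL-Real_Asymp.Real_Asymp"
begin

text \<open>
  Write \<open>D\<^sub>n = S\<^sub>n - E\<^sub>n\<close> and \<open>d = 1 + \<gamma>\<close>. The proof follows the method of Gal and Koksma: a dyadic
  maximal inequality takes the place of independence, and \<open>E\<^sub>n\<close> itself serves as the time scale.

  Since \<open>E\<close> grows by steps of at most 1, the first time \<open>\<nu> j\<close> at which \<open>E\<close> has gained \<open>j\<close> since time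
  \<open>N\<close> satisfies \<open>E\<^sub>N + j \<le> E (\<nu> j) < E\<^sub>N + j + 1\<close> (\<open>unit_passage_times\<close>). Sampling the deviation at
  these times gives variables \<open>Y j = D (\<nu> j)\<close>, and the variance hypothesis becomes
  \<open>\<E>(Y j - Y i)\<^sup>2 \<le> B (j - i) powr d\<close> for \<open>i < j\<close>.

  Any \<open>j \<le> 2 ^ r\<close> is reached from \<open>0\<close> by at most one dyadic interval of each length
  \<open>1, 2, 4, \<dots>, 2 ^ r\<close>. By Cauchy-Schwarz, \<open>(Y j - Y 0)\<^sup>2\<close> is at most \<open>r + 1\<close> times the sum of the
  squared increments over all dyadic intervals in \<open>[0, 2 ^ r]\<close>, the dyadic energy
  (\<open>dyadic_maximal_inequality\<close>). As \<open>d \<ge> 1\<close>, each of the \<open>r + 1\<close> lengths contributes at most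
  \<open>B * 2 powr (r * d)\<close> to the expected energy (\<open>dyadic_energy_expectation\<close>). Hence the energies divided
  by \<open>2 powr (r * d) * (r + 1)\<^sup>2 * ln (r + 2) powr (1 + \<epsilon>)\<close> have expectations dominated by the
  convergent series of \<open>1 / ((r + 1) * ln (r + 2) powr (1 + \<epsilon>))\<close>, and so they tend to 0 almost surely
  (\<open>AE_dyadic_energy_negligible\<close>). The exponent \<open>3 / 2\<close> of the logarithm thus arises from three factors
  \<open>r\<close> in the square: one from Cauchy-Schwarz, one from the number of lengths and one from the
  convergence of the series; the iterated logarithm makes the series converge.

  What remains is deterministic (\<open>deviation_negligible_if_energy_negligible\<close>). For \<open>2 ^ r\<close> comparable
  to \<open>E\<^sub>n\<close> the weight becomes the square of the normaliser at \<open>E\<^sub>n\<close>, and because \<open>S\<close> and \<open>E\<close> are both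
  monotone, \<open>D\<^sub>n\<close> differs by at most 2 from values between the deviations at the two passage times
  around \<open>n\<close>.
\<close>

section \<open>Two convergence criteria\<close>

text \<open>
  By monotone convergence the sum of all the \<open>W r\<close> has finite integral, so it is finite almost
  everywhere, and the terms of a convergent series tend to 0.
\<close>

lemma AE_tendsto_0_if_summable_integral:
  fixes W :: "nat \<Rightarrow> 'a \<Rightarrow> real"
  assumes int: "\<And>r. integrable M (W r)"
    and nonneg: "\<And>r \<omega>. 0 \<le> W r \<omega>"
    and le: "\<And>r. (\<integral>\<omega>. W r \<omega> \<partial>M) \<le> b r"
    and summ: "summable b"
  shows "AE \<omega> in M. (\<lambda>r. W r \<omega>) \<longlonglongrightarrow> 0"
proof -
  have b0: "0 \<le> b r" for r
    using le[of r] Bochner_Integration.integral_nonneg[of M "W r"] nonneg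
    by (meson order_trans)
  have meas: "(\<lambda>\<omega>. ennreal (W r \<omega>)) \<in> borel_measurable M" for r
    using int[of r] by measurable
  have "(\<integral>\<^sup>+\<omega>. (\<Sum>r. ennreal (W r \<omega>)) \<partial>M) = (\<Sum>r. \<integral>\<^sup>+\<omega>. ennreal (W r \<omega>) \<partial>M)"
    by (rule nn_integral_suminf) (rule meas)
  also have "\<dots> \<le> (\<Sum>r. ennreal (b r))"
    by (intro suminf_le) (auto simp: nn_integral_eq_integral int nonneg le ennreal_leI)
  also have "\<dots> = ennreal (\<Sum>r. b r)"
    by (rule suminf_ennreal2[OF b0 summ])
  finally have "(\<integral>\<^sup>+\<omega>. (\<Sum>r. ennreal (W r \<omega>)) \<partial>M) \<noteq> \<infinity>"
    by (auto simp: top_unique)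
  then have "AE \<omega> in M. (\<Sum>r. ennreal (W r \<omega>)) \<noteq> \<infinity>"
    using meas by (intro nn_integral_PInf_AE) auto
  then show ?thesis
    by eventually_elim
       (auto intro!: summable_LIMSEQ_zero summable_suminf_not_top simp: nonneg)
qed

text \<open>
  Cauchy condensation turns this Bertrand series into one dominated by a multiple of
  \<open>\<Sum>n powr - (1 + \<epsilon>)\<close>.
  The shift inside the logarithm makes the terms well-defined and decreasing from the start.
\<close>

lemma summable_inverse_times_ln_powr:
  fixes \<epsilon> :: real
  assumes "0 < \<epsilon>"
  shows "summable (\<lambda>r. 1 / (real (r + 1) * ln (real (r + 2)) powr (1 + \<epsilon>)))"
proof -
  define f where "f m = 1 / (real m * ln (real (m + 1)) powr (1 + \<epsilon>))" for m
  have "f (Suc m) \<le> f m" if "0 < m" for m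
    unfolding f_def using that assms
    by (intro divide_left_mono mult_mono powr_mono2 mult_pos_pos) auto
  moreover have "0 \<le> f m" for m
    by (simp add: f_def)
  ultimately have "summable f \<longleftrightarrow> summable (\<lambda>n. 2 ^ n * f (2 ^ n))"
    by (rule condensation_test)
  moreover have "summable (\<lambda>n. 2 ^ n * f (2 ^ n))"
  proof (rule summable_comparison_test_ev)
    have "2 ^ n * f (2 ^ n) \<le> ln 2 powr (- (1 + \<epsilon>)) * real n powr (- (1 + \<epsilon>))" if "1 \<le> n" for n
    proof -
      have "2 ^ n * f (2 ^ n) = ln (2 ^ n + 1) powr (- (1 + \<epsilon>))"
        unfolding f_def by (subst powr_minus_divide) (simp add: add.commute)
      also have "\<dots> \<le> ln (2 ^ n) powr (- (1 + \<epsilon>))"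
        using that assms by (intro powr_mono2' ln_mono) auto
      also have "\<dots> = (ln 2 * real n) powr (- (1 + \<epsilon>))"
        by (simp add: ln_realpow mult.commute)
      finally show ?thesis by (simp add: powr_mult)
    qed
    then show "\<forall>\<^sub>F n in sequentially. norm (2 ^ n * f (2 ^ n))
        \<le> ln 2 powr (- (1 + \<epsilon>)) * real n powr (- (1 + \<epsilon>))"
      by (intro eventually_sequentiallyI[of 1]) (simp add: f_def)
    show "summable (\<lambda>n. ln 2 powr (- (1 + \<epsilon>)) * real n powr (- (1 + \<epsilon>)))"
      using assms by (intro summable_mult) (simp add: summable_real_powr_iff)
  qed
  ultimately have "summable f" by simp
  then have "summable (\<lambda>r. f (r + 1))" by (subst summable_iff_shift)
  then show ?thesis by (simp add: f_def add.commute)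
qed

section \<open>The dyadic maximal inequality\<close>

text \<open>
  The sum of \<open>(a ((i + 1) * 2 ^ s) - a (i * 2 ^ s))\<^sup>2\<close> over all \<open>s \<le> r\<close> and \<open>i < 2 ^ (r - s)\<close>. The
  recursion splits off the intervals of length 1 and passes to the even-indexed subsequence, so that
  facts about the energy follow by induction on \<open>r\<close> for all sequences at once.
\<close>

fun dyadic_energy :: "nat \<Rightarrow> (nat \<Rightarrow> real) \<Rightarrow> real" where
  "dyadic_energy 0 a = (a 1 - a 0)\<^sup>2"
| "dyadic_energy (Suc r) a =
     (\<Sum>i<2 ^ Suc r. (a (Suc i) - a i)\<^sup>2) + dyadic_energy r (\<lambda>i. a (2 * i))"

lemma dyadic_energy_nonneg: "0 \<le> dyadic_energy r a"
  by (induction r arbitrary: a) (auto intro!: add_nonneg_nonneg sum_nonneg)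

text \<open>
  The Cauchy-Schwarz inequality for the vectors \<open>(1, sqrt c)\<close> and \<open>(x, y / sqrt c)\<close>. With \<open>c\<close> the
  number of levels already treated, it increases the constant of the maximal inequality by exactly 1
  per level.
\<close>

lemma square_add_le_weighted:
  fixes x y c :: real
  assumes "0 < c"
  shows "(x + y)\<^sup>2 \<le> (1 + c) * (x\<^sup>2 + y\<^sup>2 / c)"
proof -
  have "(1 + c) * (x\<^sup>2 + y\<^sup>2 / c) - (x + y)\<^sup>2 = (c * x - y)\<^sup>2 / c"
    using assms by (simp add: field_simps power2_eq_square)
  also have "\<dots> \<ge> 0" using assms by simp
  finally show ?thesis by simp
qed

text \<open>
  Rounding \<open>j\<close> down to an even number costs at most one increment of length 1, which is part of the
  finest level of the energy; the even number is treated inductively in the subsequence \<open>a (2 * i)\<close>.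
\<close>

lemma dyadic_maximal_inequality:
  assumes "j \<le> 2 ^ r"
  shows "(a j - a 0)\<^sup>2 \<le> real (r + 1) * dyadic_energy r a"
  using assms
proof (induction r arbitrary: j a)
  case 0
  then have "j = 0 \<or> j = 1" by auto
  then show ?case by auto
next
  case (Suc r)
  define i where "i = 2 * (j div 2)"
  let ?Z = "\<Sum>i<2 ^ Suc r. (a (Suc i) - a i)\<^sup>2"
  let ?Q = "dyadic_energy r (\<lambda>i. a (2 * i))"
  have rest: "(a i - a 0)\<^sup>2 \<le> real (r + 1) * ?Q"
    using Suc.IH[of "j div 2" "\<lambda>i. a (2 * i)"] Suc.prems by (simp add: i_def)
  have step: "(a j - a i)\<^sup>2 \<le> ?Z"
  proof (cases "even j")
    case True
    then show ?thesis by (auto simp: i_def intro!: sum_nonneg)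
  next
    case False
    then have j: "j = Suc i" by (simp add: i_def)
    then have "i \<in> {..<2 ^ Suc r}" using Suc.prems by simp
    then show ?thesis unfolding j by (intro member_le_sum) auto
  qed
  have "(a j - a 0)\<^sup>2 = ((a j - a i) + (a i - a 0))\<^sup>2" by simp
  also have "\<dots> \<le> (1 + real (r + 1)) * ((a j - a i)\<^sup>2 + (a i - a 0)\<^sup>2 / real (r + 1))"
    by (rule square_add_le_weighted) simp
  also have "\<dots> \<le> (1 + real (r + 1)) * (?Z + ?Q)"
    using rest step by (intro mult_left_mono add_mono) (auto simp: field_simps)
  finally show ?case by simp
qed

text \<open>
  Passing to the even-indexed subsequence replaces \<open>B\<close> by \<open>B * 2 powr d\<close>, so the coarser levels come
  from the induction hypothesis. The finest level has \<open>2 ^ r\<close> terms bounded by \<open>B\<close>, and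
  \<open>2 ^ r \<le> 2 powr (r * d)\<close> because \<open>d \<ge> 1\<close>: this is where the superadditivity of the variance bound
  enters.
\<close>

lemma dyadic_energy_expectation:
  fixes Y :: "nat \<Rightarrow> 'a \<Rightarrow> real"
  assumes int: "\<And>i j. integrable M (\<lambda>\<omega>. (Y j \<omega> - Y i \<omega>)\<^sup>2)"
    and le: "\<And>i j. i < j \<Longrightarrow> (\<integral>\<omega>. (Y j \<omega> - Y i \<omega>)\<^sup>2 \<partial>M) \<le> B * real (j - i) powr d"
    and "1 \<le> d" "0 \<le> B"
  shows "integrable M (\<lambda>\<omega>. dyadic_energy r (\<lambda>j. Y j \<omega>)) \<and>
    (\<integral>\<omega>. dyadic_energy r (\<lambda>j. Y j \<omega>) \<partial>M) \<le> B * real (r + 1) * 2 powr (real r * d)"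
  using int le \<open>0 \<le> B\<close>
proof (induction r arbitrary: Y B)
  case 0
  then show ?case using "0.prems"(2)[of 0 1] by simp
next
  case (Suc r)
  have "(\<integral>\<omega>. (Y (2 * j) \<omega> - Y (2 * i) \<omega>)\<^sup>2 \<partial>M) \<le> (B * 2 powr d) * real (j - i) powr d"
    if "i < j" for i j
    using Suc.prems(2)[of "2 * i" "2 * j"] that
    by (simp add: powr_mult right_diff_distrib' [symmetric] mult.assoc del: of_nat_diff)
  then have IH: "integrable M (\<lambda>\<omega>. dyadic_energy r (\<lambda>j. Y (2 * j) \<omega>))"
    "(\<integral>\<omega>. dyadic_energy r (\<lambda>j. Y (2 * j) \<omega>) \<partial>M)
       \<le> B * 2 powr d * real (r + 1) * 2 powr (real r * d)"
    using Suc.IH[of "\<lambda>j. Y (2 * j)" "B * 2 powr d"] Suc.prems by auto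
  have "(\<integral>\<omega>. (\<Sum>i<2 ^ Suc r. (Y (Suc i) \<omega> - Y i \<omega>)\<^sup>2) \<partial>M)
      = (\<Sum>i<2 ^ Suc r. (\<integral>\<omega>. (Y (Suc i) \<omega> - Y i \<omega>)\<^sup>2 \<partial>M))"
    by (rule Bochner_Integration.integral_sum) (rule Suc.prems)
  also have "\<dots> \<le> (\<Sum>i<(2::nat) ^ Suc r. B)"
    using Suc.prems(2)[of i "Suc i" for i] by (intro sum_mono) simp
  also have "\<dots> = B * 2 powr (real (Suc r) * 1)"
    by (simp only: mult_1_right powr_realpow) simp
  also have "\<dots> \<le> B * 2 powr (real (Suc r) * d)"
    using \<open>1 \<le> d\<close> Suc.prems by (intro mult_left_mono powr_mono) auto
  finally have fine: "(\<integral>\<omega>. (\<Sum>i<2 ^ Suc r. (Y (Suc i) \<omega> - Y i \<omega>)\<^sup>2) \<partial>M)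
      \<le> B * 2 powr (real (Suc r) * d)" .
  have "B * 2 powr d * real (r + 1) * 2 powr (real r * d)
      = B * real (r + 1) * 2 powr (real (Suc r) * d)"
    by (simp add: powr_add algebra_simps)
  then show ?case
    using fine IH Suc.prems(1) by (simp add: algebra_simps del: sum.lessThan_Suc power_Suc)
qed

lemma AE_dyadic_energy_negligible:
  fixes Y :: "nat \<Rightarrow> 'a \<Rightarrow> real"
  assumes int: "\<And>i j. integrable M (\<lambda>\<omega>. (Y j \<omega> - Y i \<omega>)\<^sup>2)"
    and le: "\<And>i j. i < j \<Longrightarrow> (\<integral>\<omega>. (Y j \<omega> - Y i \<omega>)\<^sup>2 \<partial>M) \<le> B * real (j - i) powr d"
    and "1 \<le> d" "0 \<le> B" "0 < \<epsilon>"
  shows "AE \<omega> in M. (\<lambda>r. dyadic_energy r (\<lambda>j. Y j \<omega>) /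
    (2 powr (real r * d) * real (r + 1) ^ 2 * ln (real (r + 2)) powr (1 + \<epsilon>))) \<longlonglongrightarrow> 0"
proof (rule AE_tendsto_0_if_summable_integral)
  let ?w = "\<lambda>r. 2 powr (real r * d) * real (r + 1) ^ 2 * ln (real (r + 2)) powr (1 + \<epsilon>)"
  note energy = dyadic_energy_expectation[OF int le \<open>1 \<le> d\<close> \<open>0 \<le> B\<close>]
  show "integrable M (\<lambda>\<omega>. dyadic_energy r (\<lambda>j. Y j \<omega>) / ?w r)" for r
    using energy by simp
  show "0 \<le> dyadic_energy r (\<lambda>j. Y j \<omega>) / ?w r" for r \<omega>
    by (simp add: dyadic_energy_nonneg)
  show "(\<integral>\<omega>. dyadic_energy r (\<lambda>j. Y j \<omega>) / ?w r \<partial>M)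
      \<le> B * (1 / (real (r + 1) * ln (real (r + 2)) powr (1 + \<epsilon>)))" for r
  proof -
    have "(\<integral>\<omega>. dyadic_energy r (\<lambda>j. Y j \<omega>) / ?w r \<partial>M)
        \<le> (B * real (r + 1) * 2 powr (real r * d)) / ?w r"
      unfolding integral_divide_zero
      by (intro divide_right_mono conjunct2[OF energy]) auto
    also have "\<dots> = B * (1 / (real (r + 1) * ln (real (r + 2)) powr (1 + \<epsilon>)))"
      by (simp add: power2_eq_square divide_simps)
    finally show ?thesis .
  qed
  show "summable (\<lambda>r. B * (1 / (real (r + 1) * ln (real (r + 2)) powr (1 + \<epsilon>))))"
    by (intro summable_mult summable_inverse_times_ln_powr \<open>0 < \<epsilon>\<close>)
qed

section \<open>Passage times and interpolation\<close>

text \<open>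
  A sequence with steps of at most 1 cannot overshoot a level by 1 or more when it first reaches it.
  Consequently consecutive passage times differ.
\<close>

lemma unit_passage_times:
  fixes E :: "nat \<Rightarrow> real"
  assumes "mono E" and step: "\<And>n. E (Suc n) \<le> E n + 1"
    and "filterlim E at_top sequentially"
  obtains \<nu> :: "nat \<Rightarrow> nat"
  where "\<nu> 0 = N" "strict_mono \<nu>"
    "\<And>j. E N + real j \<le> E (\<nu> j)" "\<And>j. E (\<nu> j) < E N + real j + 1"
    "\<And>n j. N \<le> n \<Longrightarrow> E N + real j \<le> E n \<Longrightarrow> \<nu> j \<le> n"
proof -
  let ?P = "\<lambda>j n. N \<le> n \<and> E N + real j \<le> E n"
  define \<nu> where "\<nu> j = (LEAST n. ?P j n)" for j
  have "\<exists>n. ?P j n" for j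
  proof -
    have "\<forall>\<^sub>F n in sequentially. E N + real j \<le> E n"
      using assms(3) by (simp add: filterlim_at_top)
    then have "\<forall>\<^sub>F n in sequentially. ?P j n"
      using eventually_ge_at_top[of N] by eventually_elim simp
    then show ?thesis by (rule eventually_happens'[rotated]) simp
  qed
  then have P: "?P j (\<nu> j)" for j
    unfolding \<nu>_def by (rule LeastI_ex)
  have least: "\<nu> j \<le> n" if "N \<le> n" "E N + real j \<le> E n" for j n
    unfolding \<nu>_def using that by (intro Least_le) auto
  have \<nu>0: "\<nu> 0 = N"
    using P[of 0] least[of N 0] by simp
  have upper: "E (\<nu> j) < E N + real j + 1" for j
  proof (cases "\<nu> j = N")
    case False
    then obtain m where m: "\<nu> j = Suc m" "N \<le> m"
      using P[of j] by (cases "\<nu> j") auto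
    then have "E m < E N + real j"
      using least[of m j] by force
    then show ?thesis using step[of m] m by simp
  qed simp
  have "strict_mono \<nu>"
  proof (rule strict_mono_Suc_iff[THEN iffD2], rule allI)
    fix j
    have "E (\<nu> j) < E (\<nu> (Suc j))"
      using upper[of j] P[of "Suc j"] by simp
    then show "\<nu> j < \<nu> (Suc j)"
      using \<open>mono E\<close> by (meson leD leI monoD)
  qed
  then show thesis using that \<nu>0 P upper least by blast
qed

text \<open>
  If \<open>\<nu> j \<le> n < \<nu> (j + 1)\<close>, then \<open>S n\<close> lies between \<open>S (\<nu> j)\<close> and \<open>S (\<nu> (j + 1))\<close>, whereas \<open>E\<close> varies
  by less than 2 over this stretch.
\<close>

lemma deviation_between_passage_times:
  fixes S E :: "nat \<Rightarrow> real"
  assumes "mono S" "mono E"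
    and lower: "\<And>j. E N + real j \<le> E (\<nu> j)" and upper: "\<And>j. E (\<nu> j) < E N + real j + 1"
    and least: "\<And>n j. N \<le> n \<Longrightarrow> E N + real j \<le> E n \<Longrightarrow> \<nu> j \<le> n"
    and "N \<le> n"
    and bound: "\<And>j. real j \<le> E n - E N + 1 \<Longrightarrow> \<bar>S (\<nu> j) - E (\<nu> j)\<bar> \<le> c"
  shows "\<bar>S n - E n\<bar> \<le> c + 2"
proof -
  define j where "j = nat \<lfloor>E n - E N\<rfloor>"
  have "E N \<le> E n" using \<open>mono E\<close> \<open>N \<le> n\<close> by (rule monoD)
  then have j: "real j \<le> E n - E N" "E n - E N < real j + 1"
    unfolding j_def by linarith+
  have "\<nu> j \<le> n" using least[of n j] j \<open>N \<le> n\<close> by simp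
  then have "S (\<nu> j) \<le> S n" using \<open>mono S\<close> by (rule monoD[rotated])
  have "E n < E (\<nu> (Suc j))" using lower[of "Suc j"] j by simp
  then have "n \<le> \<nu> (Suc j)" using \<open>mono E\<close> by (meson leD le_cases monoD)
  then have "S n \<le> S (\<nu> (Suc j))" using \<open>mono S\<close> by (rule monoD[rotated])
  then show ?thesis
    using \<open>S (\<nu> j) \<le> S n\<close> bound[of j] bound[of "Suc j"] j lower[of j] upper[of "Suc j"]
    by simp
qed

section \<open>The normalising sequence\<close>

text \<open>
  If \<open>2 ^ r \<le> 4 * x\<close>, then \<open>r\<close> is \<open>O(ln x)\<close> and \<open>ln r\<close> is \<open>O(ln (ln x))\<close>. The weight is the one that
  makes the energy negligible, times the factor \<open>r + 1\<close> of the maximal inequality.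
\<close>

lemma dyadic_weight_le_normaliser_square:
  fixes d \<epsilon> :: real
  assumes "1 \<le> d" "0 < \<epsilon>"
  shows "\<forall>\<^sub>F x in at_top. \<forall>r. 2 ^ r \<le> 4 * x \<longrightarrow>
    2 powr (real r * d) * real (r + 1) ^ 3 * ln (real (r + 2)) powr (1 + \<epsilon>)
      \<le> (4 powr d * 64 * 2 powr (1 + \<epsilon>)) *
         (x powr (d / 2) * ln x powr (3 / 2) * ln (ln x) powr ((1 + \<epsilon>) / 2))\<^sup>2"
proof -
  have log2: "log 2 x \<le> 2 * ln x" if "1 < x" for x :: real
  proof -
    have "ln x * 1 \<le> ln x * (2 * ln 2)"
      using that ln2_ge_two_thirds by (intro mult_left_mono) auto
    then show ?thesis by (simp add: log_def field_simps)
  qed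
  have "\<forall>\<^sub>F x :: real in at_top. 2 * ln x + 3 \<le> 4 * ln x" by real_asymp
  moreover have "\<forall>\<^sub>F x :: real in at_top. ln (2 * ln x + 4) \<le> 2 * ln (ln x)" by real_asymp
  moreover have "\<forall>\<^sub>F x :: real in at_top. 1 < ln x" by real_asymp
  moreover have "\<forall>\<^sub>F x :: real in at_top. 1 < x" by real_asymp
  ultimately show ?thesis
  proof eventually_elim
    case (elim x)
    show ?case
    proof (intro allI impI)
      fix r :: nat
      assume r: "2 ^ r \<le> 4 * x"
      then have "log 2 (2 ^ r) \<le> log 2 (4 * x)"
        using elim by (subst log_le_cancel_iff) auto
      also have "log 2 (4 * x) = log 2 (2 ^ 2) + log 2 x"
        using elim by (simp add: log_mult_pos)
      finally have rle: "real r \<le> 2 + 2 * ln x"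
        using log2[of x] elim by (simp only: log_pow_cancel) simp
      have 1: "2 powr (real r * d) \<le> 4 powr d * x powr d"
      proof -
        have "2 powr (real r * d) = (2 ^ r) powr d"
          by (simp add: powr_powr [symmetric] powr_realpow)
        also have "\<dots> \<le> (4 * x) powr d"
          using r assms by (intro powr_mono2) auto
        finally show ?thesis using elim by (simp add: powr_mult)
      qed
      have "real (r + 1) ^ 3 \<le> (4 * ln x) ^ 3"
        using rle elim by (intro power_mono) auto
      then have 2: "real (r + 1) ^ 3 \<le> 64 * ln x powr 3"
        using elim by (simp add: power_mult_distrib powr_numeral)
      have "ln (real (r + 2)) \<le> ln (2 * ln x + 4)"
        using rle by (intro ln_mono) auto
      also note elim(2)
      finally have "ln (real (r + 2)) powr (1 + \<epsilon>) \<le> (2 * ln (ln x)) powr (1 + \<epsilon>)"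
        using elim assms by (intro powr_mono2) auto
      then have 3: "ln (real (r + 2)) powr (1 + \<epsilon>) \<le> 2 powr (1 + \<epsilon>) * ln (ln x) powr (1 + \<epsilon>)"
        using elim by (simp add: powr_mult)
      have "2 powr (real r * d) * real (r + 1) ^ 3 * ln (real (r + 2)) powr (1 + \<epsilon>)
          \<le> (4 powr d * x powr d) * (64 * ln x powr 3)
             * (2 powr (1 + \<epsilon>) * ln (ln x) powr (1 + \<epsilon>))"
        using 1 2 3 by (intro mult_mono) auto
      also have "\<dots> = (4 powr d * 64 * 2 powr (1 + \<epsilon>)) *
         (x powr (d / 2) * ln x powr (3 / 2) * ln (ln x) powr ((1 + \<epsilon>) / 2))\<^sup>2"
      proof -
        have sq: "y powr z = (y powr (z / 2))\<^sup>2" for y z :: real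
          by (simp add: power2_eq_square powr_add [symmetric])
        show ?thesis
          unfolding sq[of x d] sq[of "ln x" 3] sq[of "ln (ln x)" "1 + \<epsilon>"] power_mult_distrib
          by (simp only: mult_ac)
      qed
      finally show "2 powr (real r * d) * real (r + 1) ^ 3 * ln (real (r + 2)) powr (1 + \<epsilon>)
          \<le> (4 powr d * 64 * 2 powr (1 + \<epsilon>)) *
         (x powr (d / 2) * ln x powr (3 / 2) * ln (ln x) powr ((1 + \<epsilon>) / 2))\<^sup>2" .
    qed
  qed
qed

text \<open>
  At time \<open>n\<close> the maximal inequality is applied at the level \<open>r\<close> with \<open>2 * E n \<le> 2 ^ r \<le> 4 * E n\<close>. The
  lower bound makes the dyadic range contain every passage time needed to control \<open>n\<close>, and the upper
  bound keeps the weight of that level comparable to the square of the normaliser.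
\<close>

lemma deviation_negligible_if_energy_negligible:
  fixes S E :: "nat \<Rightarrow> real" and d \<epsilon> :: real
  assumes "mono S" "mono E" "filterlim E at_top sequentially"
    and \<nu>: "\<And>j. E N + real j \<le> E (\<nu> j)" "\<And>j. E (\<nu> j) < E N + real j + 1"
      "\<And>n j. N \<le> n \<Longrightarrow> E N + real j \<le> E n \<Longrightarrow> \<nu> j \<le> n"
    and "0 \<le> E N" "1 \<le> d" "0 < \<epsilon>"
    and energy: "(\<lambda>r. dyadic_energy r (\<lambda>j. S (\<nu> j) - E (\<nu> j)) /
      (2 powr (real r * d) * real (r + 1) ^ 2 * ln (real (r + 2)) powr (1 + \<epsilon>)))
        \<longlonglongrightarrow> 0"
  shows "(\<lambda>n. (S n - E n) / (E n powr (d / 2) * ln (E n) powr (3 / 2)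
    * ln (ln (E n)) powr ((1 + \<epsilon>) / 2))) \<longlonglongrightarrow> 0"
proof -
  define a where "a j = S (\<nu> j) - E (\<nu> j)" for j
  define W where "W r = dyadic_energy r a /
      (2 powr (real r * d) * real (r + 1) ^ 2 * ln (real (r + 2)) powr (1 + \<epsilon>))" for r
  define h where "h x = x powr (d / 2) * ln x powr (3 / 2) * ln (ln x) powr ((1 + \<epsilon>) / 2)"
    for x :: real
  define K where "K = 4 powr d * 64 * 2 powr (1 + \<epsilon>)"
  (* for x at least 1, 2 ^ R x lies between 2 * x and 4 * x *)
  define R where "R x = nat \<lceil>log 2 x\<rceil> + 1" for x :: real
  have W: "W \<longlonglongrightarrow> 0" using energy by (simp add: W_def [abs_def] a_def [abs_def])
  have W0: "0 \<le> W r" for r by (simp add: W_def dyadic_energy_nonneg)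
  have R_top: "filterlim R at_top at_top"
    unfolding R_def [abs_def] by real_asymp
  have h_top: "filterlim h at_top at_top"
    unfolding h_def [abs_def] using assms(8,9) by real_asymp
  have "\<forall>\<^sub>F x in at_top. \<forall>r. 2 ^ r \<le> 4 * x \<longrightarrow>
    2 powr (real r * d) * real (r + 1) ^ 3 * ln (real (r + 2)) powr (1 + \<epsilon>) \<le> K * (h x)\<^sup>2"
    using dyadic_weight_le_normaliser_square[OF assms(8,9)] by (simp only: K_def h_def)
  from eventually_compose_filterlim[OF this assms(3)]
  have growth: "\<forall>\<^sub>F n in sequentially. \<forall>r. 2 ^ r \<le> 4 * E n \<longrightarrow>
    2 powr (real r * d) * real (r + 1) ^ 3 * ln (real (r + 2)) powr (1 + \<epsilon>) \<le> K * (h (E n))\<^sup>2" .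
  have hE: "filterlim (\<lambda>n. h (E n)) at_top sequentially"
    by (rule filterlim_compose[OF h_top assms(3)])
  have E1: "\<forall>\<^sub>F n in sequentially. 1 \<le> E n" and h1: "\<forall>\<^sub>F n in sequentially. 1 \<le> h (E n)"
    using assms(3) hE by (simp_all add: filterlim_at_top)
  have "\<forall>\<^sub>F n in sequentially.
    norm ((S n - E n) / h (E n)) \<le> (\<bar>a 0\<bar> + 2) / h (E n) + sqrt (K * W (R (E n)))"
    using growth E1 h1 eventually_ge_at_top[of N]
  proof eventually_elim
    case (elim n)
    let ?r = "R (E n)"
    have "0 \<le> log 2 (E n)" using elim by simp
    then have r: "log 2 (E n) + 1 \<le> real ?r" "real ?r \<le> log 2 (E n) + 2"
      unfolding R_def by linarith+
    have r_upper: "2 ^ ?r \<le> 4 * E n"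
    proof -
      have "(2::real) ^ ?r = 2 powr real ?r" by (simp add: powr_realpow)
      also have "\<dots> \<le> 2 powr (log 2 (E n) + 2)" using r by simp
      also have "\<dots> = 4 * E n" using elim by (simp add: powr_add)
      finally show ?thesis .
    qed
    have r_lower: "2 * E n \<le> 2 ^ ?r"
    proof -
      have "2 * E n = 2 powr (log 2 (E n) + 1)" using elim by (simp add: powr_add)
      also have "\<dots> \<le> 2 powr real ?r" using r by simp
      finally show ?thesis by (simp add: powr_realpow)
    qed
    have "\<bar>a j\<bar> \<le> \<bar>a 0\<bar> + sqrt (K * W ?r) * h (E n)" if "real j \<le> E n - E N + 1" for j
    proof -
      have "real j \<le> 2 ^ ?r" using that r_lower elim \<open>0 \<le> E N\<close> by linarith
      then have "j \<le> 2 ^ ?r"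
        by (metis of_nat_le_iff of_nat_numeral of_nat_power)
      then have "(a j - a 0)\<^sup>2 \<le> real (?r + 1) * dyadic_energy ?r a"
        by (rule dyadic_maximal_inequality)
      also have "\<dots> = W ?r *
          (2 powr (real ?r * d) * real (?r + 1) ^ 3 * ln (real (?r + 2)) powr (1 + \<epsilon>))"
        by (simp add: W_def power2_eq_square power3_eq_cube)
      also have "\<dots> \<le> W ?r * (K * (h (E n))\<^sup>2)"
        using elim r_upper W0 by (intro mult_left_mono) auto
      finally have "\<bar>a j - a 0\<bar> \<le> sqrt (W ?r * (K * (h (E n))\<^sup>2))"
        by (metis real_sqrt_abs real_sqrt_le_iff)
      also have "\<dots> = sqrt (K * W ?r) * h (E n)"
        using elim by (simp add: real_sqrt_mult)
      finally show ?thesis by linarith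
    qed
    then have "\<bar>S n - E n\<bar> \<le> (\<bar>a 0\<bar> + sqrt (K * W ?r) * h (E n)) + 2"
      using assms(1,2) \<nu> elim
      by (intro deviation_between_passage_times[where \<nu> = \<nu> and N = N]) (auto simp: a_def)
    then show ?case
      using elim by (simp add: field_simps)
  qed
  moreover have "(\<lambda>n. (\<bar>a 0\<bar> + 2) / h (E n) + sqrt (K * W (R (E n)))) \<longlonglongrightarrow> 0"
  proof -
    have "(\<lambda>n. W (R (E n))) \<longlonglongrightarrow> 0"
      using filterlim_compose[OF W filterlim_compose[OF R_top assms(3)]] .
    then have "(\<lambda>n. sqrt (K * W (R (E n)))) \<longlonglongrightarrow> sqrt (K * 0)"
      by (intro tendsto_intros)
    moreover have "(\<lambda>n. (\<bar>a 0\<bar> + 2) / h (E n)) \<longlonglongrightarrow> 0"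
      by (intro real_tendsto_divide_at_top[OF tendsto_const hE])
    ultimately show ?thesis using tendsto_add by fastforce
  qed
  ultimately have "(\<lambda>n. (S n - E n) / h (E n)) \<longlonglongrightarrow> 0"
    by (rule Lim_null_comparison)
  then show ?thesis by (simp add: h_def)
qed

section \<open>Counting events\<close>

lemma mono_occurrences: "mono (\<lambda>n. occurrences A n \<omega>)"
  unfolding occurrences_def by (intro monoI sum_mono2) auto

lemma mono_sum_prob: "mono (sum_prob M A)"
  unfolding sum_prob_def by (intro monoI sum_mono2) auto

lemma sum_prob_nonneg: "0 \<le> sum_prob M A n"
  unfolding sum_prob_def by (intro sum_nonneg) simp

context prob_space
begin

lemma sum_prob_Suc_le: "sum_prob M A (Suc n) \<le> sum_prob M A n + 1"
  by (simp add: sum_prob_def)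

lemma integrable_occurrences:
  assumes "\<And>n. n \<ge> 1 \<Longrightarrow> A n \<in> events"
  shows "integrable M (occurrences A n)"
  unfolding occurrences_def [abs_def] using assms
  by (intro Bochner_Integration.integrable_sum integrable_real_indicator)
      (auto simp: emeasure_eq_measure)

lemma expectation_occurrences:
  assumes "\<And>n. n \<ge> 1 \<Longrightarrow> A n \<in> events"
  shows "expectation (occurrences A n) = sum_prob M A n"
proof -
  have "expectation (occurrences A n) = (\<Sum>k=1..n. expectation (indicator (A k)))"
    unfolding occurrences_def [abs_def] using assms
    by (intro Bochner_Integration.integral_sum integrable_real_indicator)
      (auto simp: emeasure_eq_measure)
  then show ?thesis using assms by (simp add: sum_prob_def)
qed

lemma integrable_square_occurrences:
  assumes "\<And>n. n \<ge> 1 \<Longrightarrow> A n \<in> events"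
  shows "integrable M (\<lambda>\<omega>. (occurrences A m \<omega> - occurrences A n \<omega> - c)\<^sup>2)"
proof (rule integrable_const_bound)
  have *: "0 \<le> occurrences A n \<omega> \<and> occurrences A n \<omega> \<le> real n" for n \<omega>
    using sum_bounded_above[of "{1..n}" "\<lambda>k. indicator (A k) \<omega>" "1::real"]
    by (auto simp: occurrences_def intro!: sum_nonneg)
  have "\<bar>occurrences A m \<omega> - occurrences A n \<omega> - c\<bar> \<le> real m + real n + \<bar>c\<bar>" for \<omega>
    using *[of m \<omega>] *[of n \<omega>] by linarith
  then have "(occurrences A m \<omega> - occurrences A n \<omega> - c)\<^sup>2 \<le> (real m + real n + \<bar>c\<bar>)\<^sup>2" for \<omega>
    by (intro abs_le_square_iff[THEN iffD1]) (simp add: abs_of_nonneg)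
  then show "AE \<omega> in M. norm ((occurrences A m \<omega> - occurrences A n \<omega> - c)\<^sup>2)
      \<le> (real m + real n + \<bar>c\<bar>)\<^sup>2" by simp
  show "(\<lambda>\<omega>. (occurrences A m \<omega> - occurrences A n \<omega> - c)\<^sup>2) \<in> borel_measurable M"
    using integrable_occurrences[OF assms] by measurable
qed

lemma variance_occurrences:
  assumes "\<And>n. n \<ge> 1 \<Longrightarrow> A n \<in> events"
  shows "variance (\<lambda>\<omega>. occurrences A m \<omega> - occurrences A n \<omega>) =
    expectation (\<lambda>\<omega>. ((occurrences A m \<omega> - sum_prob M A m)
      - (occurrences A n \<omega> - sum_prob M A n))\<^sup>2)"
  using assms
  by (simp add: integrable_occurrences expectation_occurrences algebra_simps)

end

theorem corollary1:
  fixes M :: "'a measure" and A :: "nat \<Rightarrow> 'a set" and \<gamma> C :: real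
  assumes "prob_space M"
    and "\<And>n. n \<ge> 1 \<Longrightarrow> A n \<in> sets M"
    and "0 \<le> \<gamma>" and "\<gamma> < 1" and "C > 0"
    and "filterlim (sum_prob M A) at_top sequentially"
    and "\<forall>\<^sub>F n in sequentially. \<forall>m>n.
           prob_space.variance M (\<lambda>\<omega>. occurrences A m \<omega> - occurrences A n \<omega>)
             \<le> C * (sum_prob M A m - sum_prob M A n) powr (1 + \<gamma>)"
  shows "\<forall>\<epsilon>::real>0. as_eq_plus_smallo M (occurrences A) (sum_prob M A)
           (\<lambda>n. sum_prob M A n powr ((1 + \<gamma>) / 2)
                * ln (sum_prob M A n) powr (3 / 2)
                * ln (ln (sum_prob M A n)) powr ((1 + \<epsilon>) / 2))"
proof (intro allI impI)
  fix \<epsilon> :: real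
  assume "0 < \<epsilon>"
  interpret prob_space M by fact
  let ?S = "occurrences A" and ?E = "sum_prob M A"
  obtain N where N: "\<And>n m. N \<le> n \<Longrightarrow> n < m \<Longrightarrow>
      variance (\<lambda>\<omega>. ?S m \<omega> - ?S n \<omega>) \<le> C * (?E m - ?E n) powr (1 + \<gamma>)"
    using assms(7) by (auto simp: eventually_sequentially)
  obtain \<nu> where \<nu>: "\<nu> 0 = N" "strict_mono \<nu>"
    "\<And>j. ?E N + real j \<le> ?E (\<nu> j)" "\<And>j. ?E (\<nu> j) < ?E N + real j + 1"
    "\<And>n j. N \<le> n \<Longrightarrow> ?E N + real j \<le> ?E n \<Longrightarrow> \<nu> j \<le> n"
    using unit_passage_times[OF mono_sum_prob sum_prob_Suc_le assms(6), where N = N] by metis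
  define Y where "Y j \<omega> = ?S (\<nu> j) \<omega> - ?E (\<nu> j)" for j \<omega>
  have int: "integrable M (\<lambda>\<omega>. (Y j \<omega> - Y i \<omega>)\<^sup>2)" for i j
  proof -
    have "(\<lambda>\<omega>. (Y j \<omega> - Y i \<omega>)\<^sup>2) =
        (\<lambda>\<omega>. (?S (\<nu> j) \<omega> - ?S (\<nu> i) \<omega> - (?E (\<nu> j) - ?E (\<nu> i)))\<^sup>2)"
      by (simp add: Y_def algebra_simps)
    then show ?thesis using integrable_square_occurrences assms(2) by simp
  qed
  have second_moment: "(\<integral>\<omega>. (Y j \<omega> - Y i \<omega>)\<^sup>2 \<partial>M)
      \<le> (C * 2 powr (1 + \<gamma>)) * real (j - i) powr (1 + \<gamma>)" if "i < j" for i j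
  proof -
    have "\<nu> i < \<nu> j" using \<nu>(2) that by (rule strict_monoD)
    have "N \<le> \<nu> i" using \<nu>(1,2) by (metis le0 strict_mono_less_eq)
    have "(\<integral>\<omega>. (Y j \<omega> - Y i \<omega>)\<^sup>2 \<partial>M) = variance (\<lambda>\<omega>. ?S (\<nu> j) \<omega> - ?S (\<nu> i) \<omega>)"
      using assms(2) by (simp add: Y_def variance_occurrences)
    also have "\<dots> \<le> C * (?E (\<nu> j) - ?E (\<nu> i)) powr (1 + \<gamma>)"
      by (rule N) fact+
    also have "\<dots> \<le> C * (2 * real (j - i)) powr (1 + \<gamma>)"
    proof (intro mult_left_mono powr_mono2)
      show "0 \<le> ?E (\<nu> j) - ?E (\<nu> i)"
        using monoD[OF mono_sum_prob less_imp_le[OF \<open>\<nu> i < \<nu> j\<close>]] by simp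
      (* the true bound is j - i + 1, which is absorbed since j - i is at least 1 *)
      show "?E (\<nu> j) - ?E (\<nu> i) \<le> 2 * real (j - i)"
        using \<nu>(3)[of i] \<nu>(4)[of j] that by linarith
    qed (use assms in auto)
    finally show ?thesis by (simp add: powr_mult)
  qed
  have "AE \<omega> in M. (\<lambda>r. dyadic_energy r (\<lambda>j. Y j \<omega>) /
    (2 powr (real r * (1 + \<gamma>)) * real (r + 1) ^ 2 * ln (real (r + 2)) powr (1 + \<epsilon>)))
      \<longlonglongrightarrow> 0"
    by (rule AE_dyadic_energy_negligible[OF int second_moment])
       (use assms \<open>0 < \<epsilon>\<close> in auto)
  then have "AE \<omega> in M. (\<lambda>n. (?S n \<omega> - ?E n) / (?E n powr ((1 + \<gamma>) / 2)
      * ln (?E n) powr (3 / 2) * ln (ln (?E n)) powr ((1 + \<epsilon>) / 2))) \<longlonglongrightarrow> 0"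
  proof eventually_elim
    case (elim \<omega>)
    show ?case
      by (rule deviation_negligible_if_energy_negligible[where \<nu> = \<nu> and N = N])
         (use elim assms(3,6) \<nu>(3-5) \<open>0 < \<epsilon>\<close> in
           \<open>simp_all add: Y_def mono_occurrences mono_sum_prob sum_prob_nonneg\<close>)
  qed
  then show "as_eq_plus_smallo M ?S ?E (\<lambda>n. ?E n powr ((1 + \<gamma>) / 2)
      * ln (?E n) powr (3 / 2) * ln (ln (?E n)) powr ((1 + \<epsilon>) / 2))"
    by (simp add: as_eq_plus_smallo_def)
qed

end
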